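(* For every integer $n\ge 0$ let $H_n$ be the $n$-hitch knot and $H_n(x)$ its generating polynomial (with $H_0$ the unknot, $H_0(x)=x$). Then $H_n(x)$ satisfies the recurrence $$H_n(x)=(x^2+4x+3)\,H_{n-1}(x)\qquad (n\ge 1),$$ and is given by the closed form $$H_n(x)=x\left(x^2+4x+3\right)^n\qquad (n\ge 0).$$
   Context: A knot (diagram) means a shadow on the sphere $S^2$: a finite collection of closed curves whose only singularities are finitely many transverse double points, called crossings, with no over/under information, considered up to planar isotopy (several components and crossingless circles are allowed). The unknot $U$ is a single simple closed curve. Each crossing can be split in two ways: remove the crossing and reconnect the four ends in one of the two planar non-crossing ways that join adjacent ends (type $0$ and type $1$ splits). A state of a knot $K$ with $m$ crossings is one of the $2^m$ diagrams obtained by choosing a split at each crossing; it is a disjoint union of simple closed curves (circles), and $|S|$ denotes the number of circles of the state $S$. The generating polynomial of $K$ is $K(x)=\sum_S x^{|S|}$, summed over all $2^m$ states. The connected sum of two knots is obtained by removing a small arc from each and joining the four endpoints by two new arcs without introducing new crossings. The $n$-hitch knot $H_n$ is the shadow obtained by joining the two loose ends of a thread of $n$ half hitches; it is the connected sum of $n$ copies of its generator $H_1$, with $H_0=U$. The generator $H_1$ is the standard three-crossing trefoil shadow (three crossings, each two of them joined by exactly two edges, with complementary regions two triangles and three bigons). It is drawn as follows. Let a diagram in a disc have four ends NW, SW (left) and NE, SE (right): one crossing $c$ on top, whose two upper ends are NW and NE; below it a horizontal row of two crossings $a,b$, where the two right ends of $a$ are joined to the two left ends of $b$, the upper left end of $a$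 and the upper right end of $b$ are joined to the lower left and lower right ends of $c$ respectively, and the lower left end of $a$ is SW and the lower right end of $b$ is SE. $H_1$ is obtained by joining NW to SW (left arc) and NE to SE (right arc); consecutive copies in $H_n$ are connected by a sum of the right arc of one copy with the left arc of the next. *)

theory Defs
  imports "HOL-Library.FuncSet" "HOL-Computational_Algebra.Polynomial"
begin

text \<open>
  A shadow is recorded by its planar diagram code.  It is cut into arcs at its crossings and at
  finitely many marked points (bivalent vertices) on its curves; every crossingless circle carries
  at least one marked point.  The elements of \<open>'e\<close> name the ends of arcs: an arc is the set of its
  two ends, a marked point is the set of the two ends meeting there, and a crossing is the
  quadruple of the ends meeting there, in clockwise order starting anywhere.  Each end belongs to
  exactly one arc and to exactly one crossing or marked point.  Inserting or deleting marked points
  and renaming ends do not change the shadow that is represented.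
\<close>

record 'e shadow =
  crossings :: "('e \<times> 'e \<times> 'e \<times> 'e) set"
  points :: "'e set set"
  arcs :: "'e set set"

definition ends :: "'e shadow \<Rightarrow> 'e set" where
  "ends K = \<Union> (arcs K)"

text \<open>
  The two ways of joining adjacent ends at a crossing.  Each of the two strands so obtained keeps
  a marked point, so that splitting a shadow gives a shadow.
\<close>

fun split :: "nat \<Rightarrow> 'e \<times> 'e \<times> 'e \<times> 'e \<Rightarrow> 'e set set" where
  "split t (a, b, c, d) = (if t = 0 then {{a, b}, {c, d}} else {{b, c}, {d, a}})"

definition choices :: "'e shadow \<Rightarrow> ('e \<times> 'e \<times> 'e \<times> 'e \<Rightarrow> nat) set" where
  "choices K = crossings K \<rightarrow>\<^sub>E {0, 1}"

definition state :: "'e shadow \<Rightarrow> ('e \<times> 'e \<times> 'e \<times> 'e \<Rightarrow> nat) \<Rightarrow> 'e shadow" where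
  "state K s =
     \<lparr>crossings = {}, points = points K \<union> (\<Union>c\<in>crossings K. split (s c) c), arcs = arcs K\<rparr>"

text \<open>
  In a shadow without crossings every end lies on one arc and at one marked point, so the
  connected components are the circles.
\<close>

definition adjacent :: "'e shadow \<Rightarrow> ('e \<times> 'e) set" where
  "adjacent S = {(x, y). {x, y} \<in> arcs S \<union> points S}"

definition circles :: "'e shadow \<Rightarrow> 'e set set" where
  "circles S = ends S // (adjacent S)\<^sup>*"

definition gen_poly :: "'e shadow \<Rightarrow> int poly" where
  "gen_poly K = (\<Sum>s\<in>choices K. monom 1 (card (circles (state K s))))"

text \<open>
  Connected sum of shadows with disjoint sets of ends, along the arc with ends \<open>p\<close>, \<open>p'\<close> of the
  first and the arc with ends \<open>q\<close>, \<open>q'\<close> of the second; \<open>p\<close> is joined to \<open>q\<close> and \<open>p'\<close> to \<open>q'\<close>.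
\<close>

definition connected_sum ::
    "'e shadow \<Rightarrow> 'e \<Rightarrow> 'e \<Rightarrow> 'e shadow \<Rightarrow> 'e \<Rightarrow> 'e \<Rightarrow> 'e shadow" where
  "connected_sum K p p' L q q' =
     \<lparr>crossings = crossings K \<union> crossings L,
      points = points K \<union> points L,
      arcs = (arcs K \<union> arcs L - {{p, p'}, {q, q'}}) \<union> {{p, q}, {p', q'}}\<rparr>"

definition unknot :: "'e \<Rightarrow> 'e \<Rightarrow> 'e shadow" where
  "unknot u v = \<lparr>crossings = {}, points = {{u, v}}, arcs = {{u, v}}\<rparr>"

datatype vertex = VA | VB | VC
datatype corner = NW | NE | SE | SW

text \<open>
  \<open>End i v k\<close> is the end at corner \<open>k\<close> of crossing \<open>v\<close> in the copy number \<open>i\<close> of the generator.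
  \<open>Top\<close> and \<open>Bottom\<close> are the two ends at a marked point on the left of the unknot.
\<close>

datatype hitch_end = Top | Bottom | End nat vertex corner

definition crossing_at :: "nat \<Rightarrow> vertex \<Rightarrow> hitch_end \<times> hitch_end \<times> hitch_end \<times> hitch_end" where
  "crossing_at i v = (End i v NW, End i v NE, End i v SE, End i v SW)"

text \<open>
  Crossing \<open>VC\<close> lies above the row formed by \<open>VA\<close> (left) and \<open>VB\<close> (right).  The last two arcs are the
  left and the right closing arc.
\<close>

definition generator :: "nat \<Rightarrow> hitch_end shadow" where
  "generator i =
     \<lparr>crossings = {crossing_at i VA, crossing_at i VB, crossing_at i VC},
      points = {},
      arcs = {{End i VA NE, End i VB NW}, {End i VA SE, End i VB SW},
              {End i VA NW, End i VC SW}, {End i VB NE, End i VC SE},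
              {End i VC NW, End i VA SW}, {End i VC NE, End i VB SE}}\<rparr>"

text \<open>The upper and the lower end of the right arc of the \<open>n\<close>-hitch knot.\<close>

fun upper_right :: "nat \<Rightarrow> hitch_end" where
  "upper_right 0 = Top"
| "upper_right (Suc n) = End n VC NE"

fun lower_right :: "nat \<Rightarrow> hitch_end" where
  "lower_right 0 = Bottom"
| "lower_right (Suc n) = End n VB SE"

fun hitch :: "nat \<Rightarrow> hitch_end shadow" where
  "hitch 0 = unknot Top Bottom"
| "hitch (Suc n) =
     connected_sum (hitch n) (upper_right n) (lower_right n)
                   (generator n) (End n VC NW) (End n VA SW)"

end

theory Submission
  imports Defs
begin

text \<open>
  The number of circles is almost additive under connected sum: choosing a split at every crossing
  of \<open>K # L\<close> is choosing a state of \<open>K\<close> and a state of \<open>L\<close>, and the circles of the resulting state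
  are those of the two states, except that the circle of \<open>K\<close> through the summing arc and the circle
  of \<open>L\<close> through its summing arc are fused into one
  (\<open>card_circles_connected_sum\<close>).  Summing over all states gives
  \<open>x (K # L)(x) = K(x) L(x)\<close> (\<open>gen_poly_connected_sum\<close>).

  Since \<open>H\<^sub>n\<^sub>+\<^sub>1 = H\<^sub>n # H\<^sub>1\<close>, it remains to know the polynomial of the trefoil shadow
  \<open>H\<^sub>1\<close>.  Of its eight states three have one circle, four have two and one has three, so that
  \<open>H\<^sub>1(x) = x (x\<^sup>2 + 4x + 3)\<close> (\<open>gen_poly_generator\<close>).  The circles of each state are listed
  explicitly in \<open>strands\<close>.  Cancelling \<open>x\<close> yields the recurrence, and the closed form follows from
  \<open>H\<^sub>0(x) = x\<close>.

  One point needs care.  Fusing two circles into one requires that a circle stays connected after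
  its summing arc is cut; with circles encoded as components of a graph this is a statement about
  that graph.  It is enough to know it on one side: if the two ends of the cut arc of \<open>L\<close>
  are joined through \<open>L\<close>, then the new arcs and this path also join the two ends of the
  cut arc of \<open>K\<close>.  Here \<open>L\<close> is the generator, and the lists of circles exhibit the path.
\<close>

section \<open>Counting circles\<close>

lemma sym_adjacent: "sym (adjacent S)"
  unfolding adjacent_def sym_def by (auto simp: insert_commute)

lemma equiv_connected: "equiv UNIV ((adjacent S)\<^sup>*)"
  by (simp add: equivI refl_rtrancl sym_rtrancl sym_adjacent trans_rtrancl)

text \<open>
  Circles are counted by labelling the ends so that two ends get the same label exactly when they
  lie on the same circle; the labels may live in any convenient type.
\<close>

lemma card_circles_eq_card_image:
  assumes f: "\<And>x y. x \<in> ends S \<Longrightarrow> y \<in> ends S \<Longrightarrow> f x = f y \<longleftrightarrow> (x, y) \<in> (adjacent S)\<^sup>*"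
  shows "card (circles S) = card (f ` ends S)"
proof -
  define cls where "cls x = (adjacent S)\<^sup>* `` {x}" for x
  have cls: "cls x = cls y \<longleftrightarrow> f x = f y" if "x \<in> ends S" "y \<in> ends S" for x y
    using f[OF that] eq_equiv_class_iff[OF equiv_connected[of S], of x y] by (simp add: cls_def)
  have *: "circles S = cls ` ends S"
    by (auto simp: circles_def quotient_def cls_def)
  define g where "g X = f (inv_into (ends S) cls X)" for X
  have g: "g (cls x) = f x" if "x \<in> ends S" for x
    unfolding g_def using that cls[of "inv_into (ends S) cls (cls x)" x]
    by (simp add: f_inv_into_f inv_into_into)
  have "bij_betw g (cls ` ends S) (f ` ends S)"
    unfolding bij_betw_def inj_on_def by (auto simp: g cls image_image)
  then show ?thesis
    unfolding * by (rule bij_betw_same_card)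
qed

lemma rtrancl_if_steps:
  assumes "\<And>x y. (x, y) \<in> R \<Longrightarrow> (x, y) \<in> Q\<^sup>*" "(x, y) \<in> R\<^sup>*"
  shows "(x, y) \<in> Q\<^sup>*"
  using assms(2) by induction (auto intro: rtrancl_trans assms(1))

text \<open>
  The circles of the sum are labelled by the circles of \<open>K\<close> and those circles of \<open>L\<close> that avoid the
  cut arc; an end on the circle of \<open>L\<close> through the cut arc is labelled by the circle of \<open>K\<close> with
  which it is fused.  Assumption \<open>strand\<close> says that cutting the arc \<open>{q, q'}\<close> leaves its two ends
  connected in \<open>L\<close>.
\<close>

lemma card_circles_connected_sum:
  fixes K L :: "'e shadow"
  assumes pK: "\<Union> (points K) \<subseteq> ends K" and pL: "\<Union> (points L) \<subseteq> ends L"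
    and disj: "ends K \<inter> ends L = {}" and fin: "finite (ends K)" "finite (ends L)"
    and p: "{p, p'} \<in> arcs K" and q: "{q, q'} \<in> arcs L"
    and strand: "(q, q') \<in> (adjacent (L\<lparr>arcs := arcs L - {{q, q'}}\<rparr>))\<^sup>*"
  shows "card (circles (connected_sum K p p' L q q')) + 1 = card (circles K) + card (circles L)"
proof -
  define S where "S = connected_sum K p p' L q q'"
  have pin: "p \<in> ends K" "p' \<in> ends K" and qin: "q \<in> ends L" "q' \<in> ends L"
    using p q by (auto simp: ends_def)
  have edgeK: "x \<in> ends K \<and> y \<in> ends K" if "(x, y) \<in> adjacent K" for x y
    using that pK by (auto simp: adjacent_def ends_def)
  have edgeL: "x \<in> ends L \<and> y \<in> ends L" if "(x, y) \<in> adjacent L" for x y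
    using that pL by (auto simp: adjacent_def ends_def)
  have endsS: "ends S = ends K \<union> ends L"
    using p q by (auto simp: S_def connected_sum_def ends_def)
  have symS: "(x, y) \<in> (adjacent S)\<^sup>* \<Longrightarrow> (y, x) \<in> (adjacent S)\<^sup>*" for x y
    by (meson sym_adjacent sym_rtrancl symD)
  have notin: "{p, p'} \<notin> arcs L" "{q, q'} \<notin> arcs K"
    using disj pin qin by (auto simp: ends_def)
  have adjS: "(x, y) \<in> adjacent S \<longleftrightarrow>
      {x, y} \<in> points K \<union> points L \<union> (arcs K - {{p, p'}}) \<union> (arcs L - {{q, q'}})
        \<union> {{p, q}, {p', q'}}" for x y
  proof -
    have "arcs K \<union> arcs L - {{p, p'}, {q, q'}} = (arcs K - {{p, p'}}) \<union> (arcs L - {{q, q'}})"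
      using notin by blast
    then show ?thesis
      by (simp add: S_def connected_sum_def adjacent_def Un_ac)
  qed
  have pq: "(p, q) \<in> (adjacent S)\<^sup>*" "(p', q') \<in> (adjacent S)\<^sup>*"
    by (auto simp: adjS)
  have qq: "(q, q') \<in> (adjacent S)\<^sup>*"
  proof (rule rtrancl_if_steps[OF _ strand])
    fix x y assume "(x, y) \<in> adjacent (L\<lparr>arcs := arcs L - {{q, q'}}\<rparr>)"
    then have "{x, y} \<in> points L \<union> (arcs L - {{q, q'}})"
      by (auto simp: adjacent_def)
    then show "(x, y) \<in> (adjacent S)\<^sup>*"
      by (intro r_into_rtrancl) (simp only: adjS Un_iff, blast)
  qed
  \<comment> \<open>The detour through \<open>L\<close> replaces the cut arc of \<open>K\<close>.\<close>
  have pp: "(p, p') \<in> (adjacent S)\<^sup>*"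
    using pq qq symS by (meson rtrancl_trans)
  have K_S: "(x, y) \<in> (adjacent S)\<^sup>*" if "(x, y) \<in> (adjacent K)\<^sup>*" for x y
  proof (rule rtrancl_if_steps[OF _ that])
    fix x y assume xy: "(x, y) \<in> adjacent K"
    show "(x, y) \<in> (adjacent S)\<^sup>*"
    proof (cases "{x, y} = {p, p'}")
      case True
      then show ?thesis using pp symS[OF pp] by (auto simp: doubleton_eq_iff)
    next
      case False
      then have "{x, y} \<in> points K \<union> (arcs K - {{p, p'}})"
        using xy by (auto simp: adjacent_def)
      then show ?thesis
        by (intro r_into_rtrancl) (simp only: adjS Un_iff, blast)
    qed
  qed
  have L_S: "(x, y) \<in> (adjacent S)\<^sup>*" if "(x, y) \<in> (adjacent L)\<^sup>*" for x y
  proof (rule rtrancl_if_steps[OF _ that])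
    fix x y assume xy: "(x, y) \<in> adjacent L"
    show "(x, y) \<in> (adjacent S)\<^sup>*"
    proof (cases "{x, y} = {q, q'}")
      case True
      then show ?thesis using qq symS[OF qq] by (auto simp: doubleton_eq_iff)
    next
      case False
      then have "{x, y} \<in> points L \<union> (arcs L - {{q, q'}})"
        using xy by (auto simp: adjacent_def)
      then show ?thesis
        by (intro r_into_rtrancl) (simp only: adjS Un_iff, blast)
    qed
  qed
  define k where "k x = (adjacent K)\<^sup>* `` {x}" for x
  define l where "l x = (adjacent L)\<^sup>* `` {x}" for x
  have k: "k x = k y \<longleftrightarrow> (x, y) \<in> (adjacent K)\<^sup>*" for x y
    using eq_equiv_class_iff[OF equiv_connected[of K], of x y] by (simp add: k_def)
  have l: "l x = l y \<longleftrightarrow> (x, y) \<in> (adjacent L)\<^sup>*" for x y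
    using eq_equiv_class_iff[OF equiv_connected[of L], of x y] by (simp add: l_def)
  have kp: "k p = k p'" and lq: "l q = l q'"
    using p q unfolding k l by (auto simp: adjacent_def)
  define f where
    "f x = (if x \<in> ends K then Inl (k x) else if l x = l q then Inl (k p) else Inr (l x))" for x
  have f_edge: "f x = f y" if xy: "(x, y) \<in> adjacent S" for x y
  proof -
    consider "(x, y) \<in> adjacent K" | "(x, y) \<in> adjacent L" | "{x, y} = {p, q}" | "{x, y} = {p', q'}"
      using xy unfolding adjS unfolding adjacent_def by auto
    then show ?thesis
    proof cases
      case 1
      then have "k x = k y" by (simp add: k r_into_rtrancl)
      then show ?thesis using edgeK[OF 1] by (simp add: f_def)
    next
      case 2
      then have "l x = l y" by (simp add: l r_into_rtrancl)
      moreover have "x \<notin> ends K" "y \<notin> ends K" using edgeL[OF 2] disj by auto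
      ultimately show ?thesis by (simp add: f_def)
    next
      case 3
      then show ?thesis using pin qin disj by (auto simp: doubleton_eq_iff f_def)
    next
      case 4
      then show ?thesis using pin qin disj kp lq by (auto simp: doubleton_eq_iff f_def)
    qed
  qed
  have f_conn: "f x = f y" if "(x, y) \<in> (adjacent S)\<^sup>*" for x y
    using that by induction (auto dest: f_edge)
  have conn_f: "(x, y) \<in> (adjacent S)\<^sup>*" if "f x = f y" for x y
  proof -
    have to_p: "(z, p) \<in> (adjacent S)\<^sup>*" if "l z = l q" for z
      using that pq(1) symS L_S unfolding l by (meson rtrancl_trans)
    show ?thesis
    proof (cases "x \<in> ends K"; cases "y \<in> ends K")
      assume "x \<in> ends K" "y \<in> ends K"
      then show ?thesis using that by (auto simp: f_def k intro: K_S)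
    next
      assume "x \<in> ends K" "y \<notin> ends K"
      then have "(x, p) \<in> (adjacent K)\<^sup>*" "l y = l q"
        using that by (auto simp: f_def k split: if_splits)
      then show ?thesis by (meson K_S to_p symS rtrancl_trans)
    next
      assume "x \<notin> ends K" "y \<in> ends K"
      then have "(p, y) \<in> (adjacent K)\<^sup>*" "l x = l q"
        using that by (auto simp: f_def k split: if_splits)
      then show ?thesis by (meson K_S to_p symS rtrancl_trans)
    next
      assume "x \<notin> ends K" "y \<notin> ends K"
      then have "l x = l y"
        using that by (auto simp: f_def split: if_splits)
      then show ?thesis by (simp add: l L_S)
    qed
  qed
  have "card (circles S) = card (f ` ends S)"
    by (rule card_circles_eq_card_image) (auto intro: f_conn conn_f)
  also have "f ` ends S = k ` ends K <+> (l ` ends L - {l q})"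
  proof
    show "f ` ends S \<subseteq> k ` ends K <+> (l ` ends L - {l q})"
      using pin by (auto simp: endsS f_def)
    have "Inr (l x) \<in> f ` ends S" if "x \<in> ends L" "l x \<noteq> l q" for x
      using that disj by (intro image_eqI[of _ _ x]) (auto simp: endsS f_def)
    moreover have "Inl (k x) \<in> f ` ends S" if "x \<in> ends K" for x
      using that by (intro image_eqI[of _ _ x]) (auto simp: endsS f_def)
    ultimately show "k ` ends K <+> (l ` ends L - {l q}) \<subseteq> f ` ends S"
      by auto
  qed
  also have "card \<dots> = card (k ` ends K) + card (l ` ends L - {l q})"
    using fin by (simp add: card_Plus)
  also have "card (l ` ends L - {l q}) = card (l ` ends L) - 1"
    using qin fin by simp
  also have "k ` ends K = circles K" by (auto simp: circles_def quotient_def k_def)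
  also have "l ` ends L = circles L" by (auto simp: circles_def quotient_def l_def)
  finally have *: "card (circles S) = card (circles K) + (card (circles L) - 1)" .
  have "circles L \<noteq> {}" "finite (circles L)"
    using fin qin unfolding \<open>l ` ends L = circles L\<close>[symmetric] by auto
  then have "card (circles L) > 0" by (simp add: card_gt_0_iff)
  with * show ?thesis by (simp add: S_def)
qed

section \<open>The generating polynomial of a connected sum\<close>

fun corners :: "'e \<times> 'e \<times> 'e \<times> 'e \<Rightarrow> 'e set" where
  "corners (a, b, c, d) = {a, b, c, d}"

text \<open>
  The incidences that the encoding of a shadow leaves implicit, as far as counting circles of states
  of connected sums depends on them.
\<close>

definition finite_shadow :: "'e shadow \<Rightarrow> bool" where
  "finite_shadow K \<longleftrightarrow> finite (ends K) \<and> \<Union> (points K) \<subseteq> ends K \<and>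
     (\<forall>c\<in>crossings K. corners c \<subseteq> ends K)"

lemma arcs_state [simp]: "arcs (state K s) = arcs K"
  by (simp add: state_def)

lemma ends_state [simp]: "ends (state K s) = ends K"
  by (simp add: ends_def)

lemma Union_points_state:
  assumes "finite_shadow K"
  shows "\<Union> (points (state K s)) \<subseteq> ends K"
proof -
  have "\<Union> (split t c) \<subseteq> corners c" for t and c :: "'a \<times> 'a \<times> 'a \<times> 'a"
    by (cases c) auto
  then have "\<Union> (split (s c) c) \<subseteq> ends K" if "c \<in> crossings K" for c
    using assms that unfolding finite_shadow_def by blast
  then show ?thesis
    using assms unfolding finite_shadow_def state_def shadow.simps by blast
qed

lemma ends_connected_sum:
  assumes "{p, p'} \<in> arcs K" "{q, q'} \<in> arcs L"
  shows "ends (connected_sum K p p' L q q') = ends K \<union> ends L"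
  using assms by (auto simp: connected_sum_def ends_def)

lemma finite_shadow_connected_sum:
  assumes "finite_shadow K" "finite_shadow L" "{p, p'} \<in> arcs K" "{q, q'} \<in> arcs L"
  shows "finite_shadow (connected_sum K p p' L q q')"
  using assms(1,2) unfolding finite_shadow_def ends_connected_sum[OF assms(3,4)]
  by (auto simp: connected_sum_def)

lemma state_connected_sum:
  "state (connected_sum K p p' L q q') s =
     connected_sum (state K (restrict s (crossings K))) p p'
                   (state L (restrict s (crossings L))) q q'"
  by (auto simp: state_def connected_sum_def)

text \<open>
  Restriction identifies the functions on a disjoint union with the pairs of functions on its parts.
\<close>

lemma sum_PiE_Un:
  fixes f g :: "('a \<Rightarrow> 'b) \<Rightarrow> 'c :: comm_semiring_0"
  assumes "A \<inter> B = {}"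
  shows "(\<Sum>s\<in>(A \<union> B) \<rightarrow>\<^sub>E T. f (restrict s A) * g (restrict s B)) =
         (\<Sum>s\<in>A \<rightarrow>\<^sub>E T. f s) * (\<Sum>s\<in>B \<rightarrow>\<^sub>E T. g s)"
proof -
  have "(\<Sum>s\<in>(A \<union> B) \<rightarrow>\<^sub>E T. f (restrict s A) * g (restrict s B)) =
        (\<Sum>(s, t)\<in>(A \<rightarrow>\<^sub>E T) \<times> (B \<rightarrow>\<^sub>E T). f s * g t)"
    by (rule sum.reindex_bij_witness[where j = "\<lambda>s. (restrict s A, restrict s B)"
          and i = "\<lambda>(s, t) x. if x \<in> A then s x else t x"])
       (use assms in \<open>auto simp: fun_eq_iff PiE_def extensional_def Pi_def split: if_splits\<close>)
  then show ?thesis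
    by (simp add: sum_product sum.cartesian_product)
qed

text \<open>
  The factor \<open>x\<close> on the left restores the circle that is lost in every state when the two circles
  through the summing arcs are fused.
\<close>

lemma gen_poly_connected_sum:
  assumes K: "finite_shadow K" and L: "finite_shadow L" and disj: "ends K \<inter> ends L = {}"
    and p: "{p, p'} \<in> arcs K" and q: "{q, q'} \<in> arcs L"
    and strand: "\<And>s. s \<in> choices L \<Longrightarrow>
      (q, q') \<in> (adjacent ((state L s)\<lparr>arcs := arcs L - {{q, q'}}\<rparr>))\<^sup>*"
  shows "[:0, 1:] * gen_poly (connected_sum K p p' L q q') = gen_poly K * gen_poly L"
proof -
  let ?S = "connected_sum K p p' L q q'"
  have "corners c \<noteq> {}" for c :: "'a \<times> 'a \<times> 'a \<times> 'a"
    by (cases c) auto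
  then have cdisj: "crossings K \<inter> crossings L = {}"
    using K L disj unfolding finite_shadow_def by blast
  have fin: "finite (ends K)" "finite (ends L)"
    using K L by (auto simp: finite_shadow_def)
  have count: "card (circles (state ?S s)) + 1 =
      card (circles (state K (restrict s (crossings K)))) +
      card (circles (state L (restrict s (crossings L))))" if "s \<in> choices ?S" for s
    unfolding state_connected_sum
  proof (rule card_circles_connected_sum)
    have "s \<in> crossings K \<union> crossings L \<rightarrow>\<^sub>E {0, 1}"
      using that by (simp add: choices_def connected_sum_def)
    then have "restrict s (crossings L) \<in> choices L"
      unfolding choices_def restrict_PiE_iff by (blast dest: PiE_mem)
    from strand[OF this]
    show "(q, q') \<in> (adjacent ((state L (restrict s (crossings L)))
        \<lparr>arcs := arcs (state L (restrict s (crossings L))) - {{q, q'}}\<rparr>))\<^sup>*"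
      by simp
  qed (simp_all add: K L fin disj p q Union_points_state)
  have "[:0, 1:] * gen_poly ?S =
      (\<Sum>s\<in>choices ?S. monom 1 (card (circles (state ?S s)) + 1))"
    by (simp add: gen_poly_def sum_distrib_left monom_Suc)
  also have "\<dots> = (\<Sum>s\<in>choices ?S.
      monom 1 (card (circles (state K (restrict s (crossings K))))) *
      monom 1 (card (circles (state L (restrict s (crossings L))))))"
    by (rule sum.cong) (simp_all only: count mult_monom mult_1)
  also have "\<dots> = gen_poly K * gen_poly L"
    unfolding gen_poly_def choices_def
    using sum_PiE_Un[OF cdisj, of "\<lambda>s. monom 1 (card (circles (state K s)))"
        "\<lambda>s. monom 1 (card (circles (state L s)))" "{0, 1}"]
    by (simp add: connected_sum_def)
  finally show ?thesis .
qed

section \<open>The states of the generator\<close>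

text \<open>
  A certificate for the circles of a shadow without crossings: each list runs through the ends of
  one circle along arcs and marked points, without closing it up and without using the arc \<open>e\<close>.
  Excluding \<open>e\<close> lets the certificate also show that cutting \<open>e\<close> leaves its ends connected.
\<close>

definition strand_decomposition :: "'e shadow \<Rightarrow> 'e set \<Rightarrow> 'e list list \<Rightarrow> bool" where
  "strand_decomposition S e css \<longleftrightarrow>
     distinct (concat css) \<and> set (concat css) = ends S \<and>
     (\<forall>c\<in>set css. c \<noteq> [] \<and> successively (\<lambda>x y. {x, y} \<in> points S \<union> (arcs S - {e})) c) \<and>
     (\<forall>d\<in>arcs S \<union> points S. \<exists>c\<in>set css. d \<subseteq> set c)"

lemma successively_connected:
  assumes "successively (\<lambda>x y. (x, y) \<in> R) c" "x \<in> set c"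
  shows "(hd c, x) \<in> R\<^sup>*"
  using assms by (induction c rule: induct_list012) (auto intro: converse_rtrancl_into_rtrancl)

lemma card_circles_strand_decomposition:
  assumes "strand_decomposition S e css"
  shows "card (circles S) = length css"
proof -
  have dist: "distinct (concat css)" and ends: "set (concat css) = ends S"
    and ne: "\<And>c. c \<in> set css \<Longrightarrow> c \<noteq> []"
    and path: "\<And>c. c \<in> set css \<Longrightarrow>
      successively (\<lambda>x y. {x, y} \<in> points S \<union> (arcs S - {e})) c"
    and edge: "\<And>d. d \<in> arcs S \<union> points S \<Longrightarrow> \<exists>c\<in>set css. d \<subseteq> set c"
    using assms unfolding strand_decomposition_def by blast+
  have uniq: "c = c'" if "c \<in> set css" "c' \<in> set css" "x \<in> set c" "x \<in> set c'" for c c' x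
    using that dist by (auto simp: distinct_concat_iff)
  define f where "f x = (THE c. c \<in> set css \<and> x \<in> set c)" for x
  have f: "f x = c" if "c \<in> set css" "x \<in> set c" for x c
    unfolding f_def using that uniq by (intro the_equality) blast+
  have conn: "(hd c, x) \<in> (adjacent S)\<^sup>*" if "c \<in> set css" "x \<in> set c" for c x
    using path[OF that(1)] that(2)
    by (intro successively_connected) (auto simp: adjacent_def elim: successively_mono)
  have f_edge: "f x = f y" if xy: "(x, y) \<in> adjacent S" for x y
    using edge[of "{x, y}"] xy f unfolding adjacent_def by force
  have "card (circles S) = card (f ` ends S)"
  proof (rule card_circles_eq_card_image)
    fix x y assume x: "x \<in> ends S" and y: "y \<in> ends S"
    show "f x = f y \<longleftrightarrow> (x, y) \<in> (adjacent S)\<^sup>*"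
    proof
      assume eq: "f x = f y"
      obtain c where "c \<in> set css" "x \<in> set c" using x ends by auto
      moreover obtain c' where "c' \<in> set css" "y \<in> set c'" using y ends by auto
      ultimately have "(hd c, x) \<in> (adjacent S)\<^sup>*" "(hd c, y) \<in> (adjacent S)\<^sup>*"
        using eq f conn by metis+
      then show "(x, y) \<in> (adjacent S)\<^sup>*"
        by (meson sym_adjacent sym_rtrancl symD rtrancl_trans)
    next
      assume "(x, y) \<in> (adjacent S)\<^sup>*"
      then show "f x = f y" by induction (auto dest: f_edge)
    qed
  qed
  also have "f ` ends S = set css"
  proof
    show "f ` ends S \<subseteq> set css" using f unfolding ends[symmetric] by force
    show "set css \<subseteq> f ` ends S"
    proof
      fix c assume c: "c \<in> set css"
      then have "hd c \<in> set c" using ne by simp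
      then show "c \<in> f ` ends S" using c f ends by (auto intro!: image_eqI[of _ _ "hd c"])
    qed
  qed
  also have "card (set css) = length css"
  proof (rule distinct_card)
    have "[] \<notin> set css" using ne by blast
    then show "distinct css" using dist by (simp add: distinct_concat_iff removeAll_id)
  qed
  finally show ?thesis .
qed

lemma strand_decomposition_connected:
  assumes "strand_decomposition S {q, q'} css" "css \<noteq> []" "hd (hd css) = q" "last (hd css) = q'"
  shows "(q, q') \<in> (adjacent (S\<lparr>arcs := arcs S - {{q, q'}}\<rparr>))\<^sup>*"
proof -
  have "successively (\<lambda>x y. {x, y} \<in> points S \<union> (arcs S - {{q, q'}})) (hd css)" "hd css \<noteq> []"
    using assms(1,2) by (auto simp: strand_decomposition_def)
  then have "(hd (hd css), last (hd css)) \<in> (adjacent (S\<lparr>arcs := arcs S - {{q, q'}}\<rparr>))\<^sup>*"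
    by (intro successively_connected) (auto simp: adjacent_def elim: successively_mono)
  then show ?thesis using assms by simp
qed

text \<open>
  The circles of the state of the generator with splits \<open>a\<close>, \<open>b\<close>, \<open>c\<close> at the crossings \<open>VA\<close>, \<open>VB\<close>,
  \<open>VC\<close>.  The first list always runs from the upper to the lower end of the left arc, which is cut
  in the connected sum.
\<close>

definition strands :: "nat \<Rightarrow> nat \<Rightarrow> nat \<Rightarrow> nat \<Rightarrow> hitch_end list list" where
  "strands i a b c =
    (let A = End i VA; B = End i VB; C = End i VC in
     if c = 0 then
       if a = 0 then
         if b = 0
         then [[C NW, C NE, B SE, B SW, A SE, A SW], [A NW, A NE, B NW, B NE, C SE, C SW]]
         else [[C NW, C NE, B SE, B NE, C SE, C SW, A NW, A NE, B NW, B SW, A SE, A SW]]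
       else
         if b = 0
         then [[C NW, C NE, B SE, B SW, A SE, A NE, B NW, B NE, C SE, C SW, A NW, A SW]]
         else [[C NW, C NE, B SE, B NE, C SE, C SW, A NW, A SW], [A NE, A SE, B SW, B NW]]
     else
       if a = 0 then
         if b = 0
         then [[C NW, C SW, A NW, A NE, B NW, B NE, C SE, C NE, B SE, B SW, A SE, A SW]]
         else [[C NW, C SW, A NW, A NE, B NW, B SW, A SE, A SW], [C NE, C SE, B NE, B SE]]
       else
         if b = 0
         then [[C NW, C SW, A NW, A SW], [C NE, C SE, B NE, B NW, A NE, A SE, B SW, B SE]]
         else [[C NW, C SW, A NW, A SW], [C NE, C SE, B NE, B SE], [A NE, A SE, B SW, B NW]])"

lemma ends_generator: "ends (generator i) = {End i v k | v k. True}"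
proof
  show "ends (generator i) \<subseteq> {End i v k | v k. True}"
    by (auto simp: ends_def generator_def)
  have "End i v k \<in> ends (generator i)" for v k
    by (cases v; cases k) (simp_all add: ends_def generator_def)
  then show "{End i v k | v k. True} \<subseteq> ends (generator i)"
    by blast
qed

lemma set_strands: "set (concat (strands i a b c)) = ends (generator i)"
proof
  show "set (concat (strands i a b c)) \<subseteq> ends (generator i)"
    by (simp add: ends_generator strands_def Let_def)
  have "End i v k \<in> set (concat (strands i a b c))" for v k
    by (cases v; cases k) (simp_all add: strands_def Let_def)
  then show "ends (generator i) \<subseteq> set (concat (strands i a b c))"
    unfolding ends_generator by blast
qed

lemma distinct_strands: "distinct (concat (strands i a b c))"
  by (simp add: strands_def Let_def)

lemma strand_decomposition_generator:
  assumes "s \<in> choices (generator i)"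
  shows "strand_decomposition (state (generator i) s) {End i VC NW, End i VA SW}
           (strands i (s (crossing_at i VA)) (s (crossing_at i VB)) (s (crossing_at i VC)))"
proof -
  define S where "S = state (generator i) s"
  define e where "e = {End i VC NW, End i VA SW}"
  let ?split = "\<lambda>v. if s (crossing_at i v) = 0
    then {{End i v NW, End i v NE}, {End i v SE, End i v SW}}
    else {{End i v NE, End i v SE}, {End i v SW, End i v NW}}"
  have pts: "points S = ?split VA \<union> ?split VB \<union> ?split VC"
    unfolding S_def state_def generator_def by (simp add: crossing_at_def Un_ac)
  have arcs: "arcs S = {{End i VA NE, End i VB NW}, {End i VA SE, End i VB SW},
              {End i VA NW, End i VC SW}, {End i VB NE, End i VC SE},
              {End i VC NW, End i VA SW}, {End i VC NE, End i VB SE}}"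
    unfolding S_def state_def generator_def by simp
  let ?css = "strands i (s (crossing_at i VA)) (s (crossing_at i VB)) (s (crossing_at i VC))"
  have "\<forall>c\<in>set ?css. c \<noteq> [] \<and> successively (\<lambda>x y. {x, y} \<in> points S \<union> (arcs S - {e})) c"
    unfolding pts arcs e_def by (simp add: strands_def Let_def doubleton_eq_iff)
  moreover have "\<forall>d\<in>arcs S \<union> points S. \<exists>c\<in>set ?css. d \<subseteq> set c"
    unfolding pts arcs by (simp add: strands_def Let_def)
  ultimately show ?thesis
    unfolding strand_decomposition_def S_def[symmetric] e_def[symmetric]
    using set_strands distinct_strands by (simp add: S_def)
qed

text \<open>
  A choice of splits is a function on the set of crossings that is undefined elsewhere; it amounts
  to the triple of its values at the three crossings.
\<close>

lemma sum_choices_generator: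
  "(\<Sum>s\<in>choices (generator i). g (s (crossing_at i VA)) (s (crossing_at i VB)) (s (crossing_at i VC))) =
     (\<Sum>a\<in>{0, 1}. \<Sum>b\<in>{0, 1}. \<Sum>c\<in>{0, 1}. g a b c)"
proof -
  have cr: "crossings (generator i) = range (crossing_at i)"
    by (auto simp: generator_def) (metis vertex.exhaust)
  have inj: "crossing_at i v = crossing_at i w \<longleftrightarrow> v = w" for v w
    by (simp add: crossing_at_def)
  \<comment> \<open>The triple as a function on vertices; \<open>THE\<close> below recovers the vertex from its crossing.\<close>
  let ?at = "\<lambda>a b c v. case v of VA \<Rightarrow> a | VB \<Rightarrow> b | VC \<Rightarrow> c"
  have "(\<Sum>s\<in>choices (generator i).
        g (s (crossing_at i VA)) (s (crossing_at i VB)) (s (crossing_at i VC))) =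
      (\<Sum>(a, b, c)\<in>{0, 1} \<times> {0, 1} \<times> {0, 1}. g a b c)"
  proof (rule sum.reindex_bij_witness[where
        j = "\<lambda>s. (s (crossing_at i VA), s (crossing_at i VB), s (crossing_at i VC))" and
        i = "\<lambda>(a, b, c). \<lambda>x\<in>range (crossing_at i). ?at a b c (THE v. x = crossing_at i v)"])
    fix s assume s: "s \<in> choices (generator i)"
    have "?at (s (crossing_at i VA)) (s (crossing_at i VB)) (s (crossing_at i VC)) v =
        s (crossing_at i v)" for v
      by (cases v) auto
    then show "(case (s (crossing_at i VA), s (crossing_at i VB), s (crossing_at i VC)) of
        (a, b, c) \<Rightarrow> \<lambda>x\<in>range (crossing_at i). ?at a b c (THE v. x = crossing_at i v)) = s"
      using s by (auto simp: choices_def cr PiE_def extensional_def fun_eq_iff inj)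
  next
    fix s assume "s \<in> choices (generator i)"
    then have "s (crossing_at i v) \<in> {0, 1}" for v
      unfolding choices_def cr by (rule PiE_mem) simp
    then show "(s (crossing_at i VA), s (crossing_at i VB), s (crossing_at i VC)) \<in>
        {0, 1} \<times> {0, 1} \<times> {0, 1}"
      by (simp only: mem_Times_iff fst_conv snd_conv)
  next
    fix t :: "nat \<times> nat \<times> nat" assume t: "t \<in> {0, 1} \<times> {0, 1} \<times> {0, 1}"
    obtain a b c where abc: "t = (a, b, c)" by (cases t)
    have "a \<in> {0, 1}" "b \<in> {0, 1}" "c \<in> {0, 1}"
      using t unfolding abc by (simp_all only: mem_Times_iff fst_conv snd_conv)
    then have "?at a b c v \<in> {0, 1}" for v
      by (cases v) simp_all
    then show "(case t of (a, b, c) \<Rightarrow>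
        \<lambda>x\<in>range (crossing_at i). ?at a b c (THE v. x = crossing_at i v)) \<in> choices (generator i)"
      unfolding abc choices_def cr
      by (simp only: prod.case)
         (intro restrict_PiE_iff[THEN iffD2], auto simp only: inj the_sym_eq_trivial)
  next
    fix t :: "nat \<times> nat \<times> nat"
    obtain a b c where abc: "t = (a, b, c)" by (cases t)
    show "(case case t of (a, b, c) \<Rightarrow>
        \<lambda>x\<in>range (crossing_at i). ?at a b c (THE v. x = crossing_at i v) of
        s \<Rightarrow> (s (crossing_at i VA), s (crossing_at i VB), s (crossing_at i VC))) = t"
      by (simp add: abc inj)
  qed simp_all
  then show ?thesis
    by (simp add: sum.cartesian_product[symmetric] add.assoc)
qed

lemma gen_poly_generator: "gen_poly (generator i) = [:0, 1:] * [:3, 4, 1:]"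
proof -
  have "gen_poly (generator i) = (\<Sum>s\<in>choices (generator i). monom 1 (length
      (strands i (s (crossing_at i VA)) (s (crossing_at i VB)) (s (crossing_at i VC)))))"
    unfolding gen_poly_def
    by (intro sum.cong refl)
       (simp only: card_circles_strand_decomposition[OF strand_decomposition_generator])
  also have "\<dots> = [:0, 1:] * [:3, 4, 1:]"
    unfolding sum_choices_generator[where g = "\<lambda>a b c. monom 1 (length (strands i a b c))"]
    by (simp add: strands_def Let_def monom_altdef numeral_eq_Suc)
  finally show ?thesis .
qed

section \<open>Hitch knots\<close>

text \<open>
  A summation cuts the copy that it adds only at the left arc, so the right arc of that copy remains.
\<close>

lemma right_arc_hitch: "{upper_right n, lower_right n} \<in> arcs (hitch n)"
proof (cases n)
  case 0
  then show ?thesis by (simp add: unknot_def)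
next
  case (Suc m)
  then show ?thesis
    by (cases m) (auto simp: connected_sum_def generator_def doubleton_eq_iff)
qed

lemma left_arc_generator: "{End i VC NW, End i VA SW} \<in> arcs (generator i)"
  by (simp add: generator_def)

lemma ends_hitch: "ends (hitch n) = {Top, Bottom} \<union> {End i v k | i v k. i < n}"
proof (induction n)
  case 0
  show ?case by (auto simp: unknot_def ends_def)
next
  case (Suc n)
  then show ?case
    by (auto simp: ends_connected_sum right_arc_hitch left_arc_generator ends_generator less_Suc_eq)
qed

lemma finite_shadow_generator: "finite_shadow (generator i)"
proof -
  have "finite (ends (generator i))"
    by (auto simp: ends_def generator_def)
  then show ?thesis
    unfolding finite_shadow_def ends_generator by (auto simp: generator_def crossing_at_def)
qed

lemma finite_shadow_hitch: "finite_shadow (hitch n)"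
proof (induction n)
  case 0
  show ?case by (simp add: finite_shadow_def unknot_def ends_def)
next
  case (Suc n)
  then show ?case
    by (simp add: finite_shadow_connected_sum finite_shadow_generator right_arc_hitch
        left_arc_generator)
qed

lemma strand_generator:
  assumes "s \<in> choices (generator i)"
  shows "(End i VC NW, End i VA SW) \<in> (adjacent ((state (generator i) s)
    \<lparr>arcs := arcs (generator i) - {{End i VC NW, End i VA SW}}\<rparr>))\<^sup>*"
proof -
  have "strands i a b c \<noteq> []" "hd (hd (strands i a b c)) = End i VC NW"
    "last (hd (strands i a b c)) = End i VA SW" for a b c
    by (simp_all add: strands_def Let_def)
  then show ?thesis
    using strand_decomposition_connected[OF strand_decomposition_generator[OF assms]] by simp
qed

lemma gen_poly_hitch_Suc: "gen_poly (hitch (Suc n)) = [:3, 4, 1:] * gen_poly (hitch n)"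
proof -
  have "ends (hitch n) \<inter> ends (generator n) = {}"
    by (auto simp: ends_hitch ends_generator)
  then have "[:0, 1:] * gen_poly (hitch (Suc n)) = gen_poly (hitch n) * gen_poly (generator n)"
    by (simp only: hitch.simps gen_poly_connected_sum finite_shadow_hitch finite_shadow_generator
        right_arc_hitch left_arc_generator strand_generator)
  also have "\<dots> = [:0, 1:] * ([:3, 4, 1:] * gen_poly (hitch n))"
    by (simp only: gen_poly_generator mult_ac)
  finally show ?thesis
    by (subst (asm) mult_cancel_left) simp
qed

lemma gen_poly_unknot: "gen_poly (unknot u v) = [:0, 1:]"
proof -
  have ends: "ends (unknot u v) = {u, v}"
    by (simp add: ends_def unknot_def)
  have "card (circles (state (unknot u v) s)) = 1" for s
  proof -
    have "(x, y) \<in> (adjacent (state (unknot u v) s))\<^sup>*" if "x \<in> {u, v}" "y \<in> {u, v}" for x y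
      using that by (auto simp: adjacent_def state_def unknot_def doubleton_eq_iff)
    then have "card (circles (state (unknot u v) s)) =
        card ((\<lambda>_. ()) ` ends (state (unknot u v) s))"
      by (intro card_circles_eq_card_image) (simp add: ends)
    then show ?thesis
      by (simp add: ends)
  qed
  then show ?thesis
    by (simp add: gen_poly_def choices_def unknot_def monom_altdef)
qed

theorem theorem32:
  "(\<forall>n\<ge>1. gen_poly (hitch n) = [:3, 4, 1:] * gen_poly (hitch (n - 1))) \<and>
   (\<forall>n. gen_poly (hitch n) = [:0, 1:] * [:3, 4, 1:] ^ n)"
proof (intro conjI allI impI)
  fix n :: nat
  assume "n \<ge> 1"
  then show "gen_poly (hitch n) = [:3, 4, 1:] * gen_poly (hitch (n - 1))"
    using gen_poly_hitch_Suc[of "n - 1"] by simp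
next
  fix n
  show "gen_poly (hitch n) = [:0, 1:] * [:3, 4, 1:] ^ n"
  proof (induction n)
    case 0
    show ?case by (simp add: gen_poly_unknot)
  next
    case (Suc n)
    then show ?case
      by (simp only: gen_poly_hitch_Suc power_Suc mult.left_commute)
  qed
qed

end
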